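(* Let $p\ge3$, let $f=f(x_1,\dots,x_p)$ be a smooth function, and let $(M,g_f)=(\mathbb{R}^{2p},g_f)$ be as defined in the context, with Hessian $H=(\partial_{x_i}\partial_{x_j}f)$. Let $P\in M$. (1) If $H(P)$ is definite, then for every non-null $x\in T_PM$, $J_W(x)$ has rank $p-1$ and $J_W(x)^2=0$. In particular, if $H$ is definite at every point, $(M,g_f)$ is conformally spacelike and conformally timelike Jordan Osserman. (2) If $H(P)$ is indefinite, then $(M,g_f)$ is neither conformally spacelike Jordan Osserman nor conformally timelike Jordan Osserman. (3) If $H(P)$ is non-degenerate, then for every oriented spacelike or timelike 2-plane $\pi\subset T_PM$, $W(\pi)$ has rank $2$ and $W(\pi)^2=0$. In particular, if $H$ is non-degenerate at every point, $(M,g_f)$ is conformally spacelike and conformally timelike Jordan Ivanov-Petrova.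
   Context: On $\mathbb{R}^{2p}$ with coordinates $(x_1,\dots,x_p,y_1,\dots,y_p)$ and a smooth $f=f(x_1,\dots,x_p)$, the neutral signature metric $g_f$ is defined by $g_f(\partial_{x_i},\partial_{x_j})=\partial_{x_i}f\cdot\partial_{x_j}f$, $g_f(\partial_{x_i},\partial_{y_j})=g_f(\partial_{y_j},\partial_{x_i})=\delta_{ij}$, $g_f(\partial_{y_i},\partial_{y_j})=0$. For a pseudo-Riemannian manifold of dimension $m\ge3$ with curvature 4-tensor $R$, Ricci tensor $\rho(x,y)=\sum_{ij}g^{ij}R(x,e_i,e_j,y)$, scalar curvature $\tau=\sum g^{ij}\rho(e_i,e_j)$, the Weyl tensor is $W(x,y,z,w)=R(x,y,z,w)-\frac1{m-2}\{\rho(x,w)g(y,z)+g(x,w)\rho(y,z)\}+\frac1{m-2}\{\rho(x,z)g(y,w)+g(x,z)\rho(y,w)\}+\frac{\tau}{(m-1)(m-2)}\{g(x,w)g(y,z)-g(x,z)g(y,w)\}$. The Jacobi operator: $g(J_W(x)y,z)=W(y,x,x,z)$. For an oriented spacelike or timelike 2-plane $\pi$ with oriented orthonormal basis $\{e_1,e_2\}$, $g(W(\pi)x,y)=W(e_1,e_2,x,y)$. Conformally spacelike (resp. timelike) Jordan Osserman: at each point $P$, the Jordan normal form of $J_{W_P}(x)$ is constant for $x$ with $g(x,x)=1$ (resp. $-1$). Conformally spacelike (resp. timelike) Jordan Ivanov-Petrova: at each point $P$, the Jordan normal form of $W_P(\pi)$ is constant over oriented spacelike (resp. timelike) 2-planes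 $\pi\subset T_PM$. (The Jordan normal form may vary with $P$.) *)

theory Defs
  imports "HOL-Analysis.Analysis"
begin

section \<open>Calculus on coordinate spaces\<close>

definition pd :: "'m::finite \<Rightarrow> (real^'m \<Rightarrow> real) \<Rightarrow> real^'m \<Rightarrow> real" where
  "pd k F P = deriv (\<lambda>t. F (P + t *\<^sub>R axis k 1)) 0"

fun iter_pd :: "'m::finite list \<Rightarrow> (real^'m \<Rightarrow> real) \<Rightarrow> real^'m \<Rightarrow> real" where
  "iter_pd [] F = F"
| "iter_pd (k # ks) F = pd k (iter_pd ks F)"

(* C^infinity: every iterated partial derivative is (Frechet) differentiable everywhere *)
definition smooth_fun :: "(real^'m::finite \<Rightarrow> real) \<Rightarrow> bool" where
  "smooth_fun F \<longleftrightarrow> (\<forall>ks x. iter_pd ks F differentiable (at x))"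

section \<open>Pseudo-Riemannian metric given by components gm P i j in global coordinates\<close>

type_synonym 'm metric = "real^'m \<Rightarrow> 'm \<Rightarrow> 'm \<Rightarrow> real"

definition gmat :: "'m::finite metric \<Rightarrow> real^'m \<Rightarrow> real^'m^'m" where
  "gmat gm P = (\<chi> i j. gm P i j)"

definition ginv :: "'m::finite metric \<Rightarrow> real^'m \<Rightarrow> 'm \<Rightarrow> 'm \<Rightarrow> real" where
  "ginv gm P i j = matrix_inv (gmat gm P) $ i $ j"

(* Christoffel symbols of the first kind: g(nabla_i d_j, d_k) *)
definition chr1 :: "'m::finite metric \<Rightarrow> real^'m \<Rightarrow> 'm \<Rightarrow> 'm \<Rightarrow> 'm \<Rightarrow> real" where
  "chr1 gm P i j k = (pd i (\<lambda>Q. gm Q j k) P + pd j (\<lambda>Q. gm Q i k) P - pd k (\<lambda>Q. gm Q i j) P) / 2"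

(* nabla_{d_i} d_j = sum_l chr i j l d_l *)
definition chr :: "'m::finite metric \<Rightarrow> real^'m \<Rightarrow> 'm \<Rightarrow> 'm \<Rightarrow> 'm \<Rightarrow> real" where
  "chr gm P i j l = (\<Sum>k\<in>UNIV. ginv gm P l k * chr1 gm P i j k)"

(* R(d_i,d_j) d_k = sum_l Rup i j k l d_l, with R(x,y) = nabla_x nabla_y - nabla_y nabla_x - nabla_[x,y] *)
definition Rup :: "'m::finite metric \<Rightarrow> real^'m \<Rightarrow> 'm \<Rightarrow> 'm \<Rightarrow> 'm \<Rightarrow> 'm \<Rightarrow> real" where
  "Rup gm P i j k l =
     pd i (\<lambda>Q. chr gm Q j k l) P - pd j (\<lambda>Q. chr gm Q i k l) P
     + (\<Sum>m\<in>UNIV. chr gm P j k m * chr gm P i m l - chr gm P i k m * chr gm P j m l)"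

(* R(d_i,d_j,d_k,d_l) = g(R(d_i,d_j)d_k, d_l) *)
definition Rcoord :: "'m::finite metric \<Rightarrow> real^'m \<Rightarrow> 'm \<Rightarrow> 'm \<Rightarrow> 'm \<Rightarrow> 'm \<Rightarrow> real" where
  "Rcoord gm P i j k l = (\<Sum>n\<in>UNIV. Rup gm P i j k n * gm P n l)"

definition gform :: "'m::finite metric \<Rightarrow> real^'m \<Rightarrow> real^'m \<Rightarrow> real^'m \<Rightarrow> real" where
  "gform gm P x y = (\<Sum>i\<in>UNIV. \<Sum>j\<in>UNIV. x$i * y$j * gm P i j)"

definition curv :: "'m::finite metric \<Rightarrow> real^'m \<Rightarrow> real^'m \<Rightarrow> real^'m \<Rightarrow> real^'m \<Rightarrow> real^'m \<Rightarrow> real" where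
  "curv gm P x y z w =
     (\<Sum>i\<in>UNIV. \<Sum>j\<in>UNIV. \<Sum>k\<in>UNIV. \<Sum>l\<in>UNIV. x$i * y$j * z$k * w$l * Rcoord gm P i j k l)"

definition ricci :: "'m::finite metric \<Rightarrow> real^'m \<Rightarrow> real^'m \<Rightarrow> real^'m \<Rightarrow> real" where
  "ricci gm P x y = (\<Sum>i\<in>UNIV. \<Sum>j\<in>UNIV. ginv gm P i j * curv gm P x (axis i 1) (axis j 1) y)"

definition scal :: "'m::finite metric \<Rightarrow> real^'m \<Rightarrow> real" where
  "scal gm P = (\<Sum>i\<in>UNIV. \<Sum>j\<in>UNIV. ginv gm P i j * ricci gm P (axis i 1) (axis j 1))"

definition weyl :: "'m::finite metric \<Rightarrow> real^'m \<Rightarrow> real^'m \<Rightarrow> real^'m \<Rightarrow> real^'m \<Rightarrow> real^'m \<Rightarrow> real" where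
  "weyl gm P x y z w =
     (let m = real CARD('m); g = gform gm P; \<rho> = ricci gm P; \<tau> = scal gm P in
      curv gm P x y z w
      - (\<rho> x w * g y z + g x w * \<rho> y z) / (m - 2)
      + (\<rho> x z * g y w + g x z * \<rho> y w) / (m - 2)
      + \<tau> / ((m - 1) * (m - 2)) * (g x w * g y z - g x z * g y w))"

(* the endomorphism T with g(T y, z) = B(y,z), B given by the matrix B$a$b = B(e_a,e_b) *)
definition op_of_form :: "'m::finite metric \<Rightarrow> real^'m \<Rightarrow> real^'m^'m \<Rightarrow> real^'m^'m" where
  "op_of_form gm P B = matrix_inv (gmat gm P) ** transpose B"

(* Jacobi operator of the Weyl tensor: g(J_W(x) y, z) = W(y,x,x,z) *)
definition jacobiW :: "'m::finite metric \<Rightarrow> real^'m \<Rightarrow> real^'m \<Rightarrow> real^'m^'m" where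
  "jacobiW gm P x = op_of_form gm P (\<chi> a b. weyl gm P (axis a 1) x x (axis b 1))"

(* W(pi) for pi spanned by the oriented orthonormal basis e1, e2: g(W(pi)x,y) = W(e1,e2,x,y) *)
definition weylPi :: "'m::finite metric \<Rightarrow> real^'m \<Rightarrow> real^'m \<Rightarrow> real^'m \<Rightarrow> real^'m^'m" where
  "weylPi gm P e1 e2 = op_of_form gm P (\<chi> a b. weyl gm P e1 e2 (axis a 1) (axis b 1))"

(* two real square matrices have the same Jordan normal form iff they are similar *)
definition same_jnf :: "real^'m^'m \<Rightarrow> real^'m^'m \<Rightarrow> bool" where
  "same_jnf A B \<longleftrightarrow> (\<exists>S. invertible S \<and> B = S ** A ** matrix_inv S)"

definition conf_spacelike_JO :: "'m::finite metric \<Rightarrow> bool" where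
  "conf_spacelike_JO gm \<longleftrightarrow> (\<forall>P x y. gform gm P x x = 1 \<and> gform gm P y y = 1
       \<longrightarrow> same_jnf (jacobiW gm P x) (jacobiW gm P y))"

definition conf_timelike_JO :: "'m::finite metric \<Rightarrow> bool" where
  "conf_timelike_JO gm \<longleftrightarrow> (\<forall>P x y. gform gm P x x = -1 \<and> gform gm P y y = -1
       \<longrightarrow> same_jnf (jacobiW gm P x) (jacobiW gm P y))"

(* {e1,e2} oriented orthonormal basis of a spacelike (eps = 1) / timelike (eps = -1) 2-plane *)
definition on_pair :: "'m::finite metric \<Rightarrow> real^'m \<Rightarrow> real \<Rightarrow> real^'m \<Rightarrow> real^'m \<Rightarrow> bool" where
  "on_pair gm P eps e1 e2 \<longleftrightarrow>
     gform gm P e1 e1 = eps \<and> gform gm P e2 e2 = eps \<and> gform gm P e1 e2 = 0"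

definition conf_spacelike_IP :: "'m::finite metric \<Rightarrow> bool" where
  "conf_spacelike_IP gm \<longleftrightarrow> (\<forall>P e1 e2 u1 u2. on_pair gm P 1 e1 e2 \<and> on_pair gm P 1 u1 u2
       \<longrightarrow> same_jnf (weylPi gm P e1 e2) (weylPi gm P u1 u2))"

definition conf_timelike_IP :: "'m::finite metric \<Rightarrow> bool" where
  "conf_timelike_IP gm \<longleftrightarrow> (\<forall>P e1 e2 u1 u2. on_pair gm P (-1) e1 e2 \<and> on_pair gm P (-1) u1 u2
       \<longrightarrow> same_jnf (weylPi gm P e1 e2) (weylPi gm P u1 u2))"

section \<open>The metric g_f on R^{2p}; coordinates Inl i = x_i, Inr i = y_i\<close>

definition xpart :: "real^('n::finite + 'n) \<Rightarrow> real^'n" where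
  "xpart P = (\<chi> i. P $ Inl i)"

definition gf :: "(real^'n::finite \<Rightarrow> real) \<Rightarrow> ('n + 'n) metric" where
  "gf f P a b = (case (a, b) of
      (Inl i, Inl j) \<Rightarrow> pd i f (xpart P) * pd j f (xpart P)
    | (Inl i, Inr j) \<Rightarrow> (if i = j then 1 else 0)
    | (Inr i, Inl j) \<Rightarrow> (if i = j then 1 else 0)
    | (Inr i, Inr j) \<Rightarrow> 0)"

definition hess :: "(real^'n::finite \<Rightarrow> real) \<Rightarrow> real^'n \<Rightarrow> real^'n^'n" where
  "hess f x = (\<chi> i j. pd i (pd j f) x)"

definition definite_mat :: "real^'n::finite^'n \<Rightarrow> bool" where
  "definite_mat H \<longleftrightarrow> (\<forall>v. v \<noteq> 0 \<longrightarrow> v \<bullet> (H *v v) > 0) \<or> (\<forall>v. v \<noteq> 0 \<longrightarrow> v \<bullet> (H *v v) < 0)"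

definition indefinite_mat :: "real^'n::finite^'n \<Rightarrow> bool" where
  "indefinite_mat H \<longleftrightarrow> (\<exists>v w. v \<bullet> (H *v v) > 0 \<and> w \<bullet> (H *v w) < 0)"

definition nondegenerate_mat :: "real^'n::finite^'n \<Rightarrow> bool" where
  "nondegenerate_mat H \<longleftrightarrow> det H \<noteq> 0"

end

(* In coordinates, the curvature tensor of g_f is R(x,y,z,w) = H(Y,Z) H(X,W) - H(X,Z) H(Y,W), where
   X, Y, Z, W are the x-parts of the arguments and H is the Hessian of f.  Its Ricci contraction
   vanishes, so W = R, and J_W(x) and W(pi) kill the y-directions and map the x-directions into the
   y-directions: they are lower-left block matrices.  Such matrices square to zero, and two of them
   are similar iff their blocks have the same rank, so everything reduces to ranks of operators
   built from H.  For nondegenerate H the Jacobi block of X /= 0 has rank p - 1 if H(X,X) /= 0 and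
   rank 1 if H(X,X) = 0; it vanishes if HX = 0.  An indefinite H has a non-null vector and either a
   kernel vector or a nonzero null vector, so for p >= 3 two ranks occur, and every value of g(x,x)
   is attained over any nonzero x-part.  The plane block has rank 2 since H E1, H E2 are independent. *)

theory Submission
  imports Defs
begin

section \<open>Linear algebra\<close>

lemma inj_on_orthogonal_comp_kernel:
  fixes f :: "'a::euclidean_space \<Rightarrow> 'b::real_vector"
  assumes f: "linear f"
  shows "inj_on f (orthogonal_comp {x. f x = 0})"
proof (rule inj_onI)
  fix x y assume "x \<in> orthogonal_comp {x. f x = 0}" "y \<in> orthogonal_comp {x. f x = 0}" "f x = f y"
  then have "x - y \<in> {x. f x = 0} \<inter> orthogonal_comp {x. f x = 0}"
    using linear_diff[OF f] subspace_diff[OF subspace_orthogonal_comp] by auto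
  then show "x = y" using orthogonal_Int_0[OF linear_subspace_kernel[OF f]] by auto
qed

lemma kernel_plus_orthogonal_comp:
  fixes f :: "'a::euclidean_space \<Rightarrow> 'b::real_vector"
  assumes "linear f"
  obtains k c where "f k = 0" "c \<in> orthogonal_comp {x. f x = 0}" "x = k + c"
proof -
  have "x \<in> {x. f x = 0} + orthogonal_comp {x. f x = 0}"
    using subspace_sum_orthogonal_comp[OF linear_subspace_kernel[OF assms]] by simp
  then show thesis using that by (auto elim: set_plus_elim)
qed

lemma dim_kernel_add_dim_range:
  fixes f :: "'a::euclidean_space \<Rightarrow> 'b::euclidean_space"
  assumes f: "linear f"
  shows "dim {x. f x = 0} + dim (range f) = DIM('a)"
proof -
  let ?K = "{x. f x = 0}"
  let ?C = "orthogonal_comp ?K"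
  have K: "subspace ?K" by (rule linear_subspace_kernel[OF f])
  have "{y. \<forall>x\<in>?K. orthogonal x y} = ?C" by (auto simp: orthogonal_comp_def)
  then have dim_C: "dim ?C + dim ?K = DIM('a)"
    using dim_subspace_orthogonal_to_vectors[OF K subspace_UNIV subset_UNIV] by (simp add: dim_UNIV)
  have "range f \<subseteq> f ` ?C"
  proof
    fix y assume "y \<in> range f"
    then obtain x where "y = f x" by blast
    moreover obtain k c where "f k = 0" "c \<in> ?C" "x = k + c"
      using kernel_plus_orthogonal_comp[OF f] .
    ultimately show "y \<in> f ` ?C" using linear_add[OF f] by auto
  qed
  then have image_C: "f ` ?C = range f" by blast
  have "span ?C = ?C" by (rule span_eq_iff[THEN iffD2, OF subspace_orthogonal_comp])
  then have "dim (f ` ?C) = dim ?C"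
    using dim_image_eq[OF f] inj_on_orthogonal_comp_kernel[OF f] by metis
  with dim_C image_C show ?thesis by simp
qed

lemma linear_inj_on_extends_to_bij:
  fixes h :: "'a::euclidean_space \<Rightarrow> 'a"
  assumes h: "linear h" and S: "subspace S" and inj: "inj_on h S"
  obtains \<phi> where "linear \<phi>" "bij \<phi>" "\<And>x. x \<in> S \<Longrightarrow> \<phi> x = h x"
proof -
  obtain B where B: "B \<subseteq> S" "independent B" "S \<subseteq> span B"
    by (meson basis_exists)
  have span_B: "span B = S" using B(1,3) S by (rule span_subspace)
  have "independent (h ` B)" using h B(2) inj unfolding span_B[symmetric]
    by (rule linear_independent_injective_image)
  moreover have "inj_on h B" using inj B(1) by (rule inj_on_subset)
  ultimately obtain \<phi> where \<phi>: "linear \<phi>" "inj \<phi>" "\<forall>x\<in>B. \<phi> x = h x"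
    using eucl.linear_independent_extend_inj[OF B(2)] by blast
  have "bij \<phi>" using \<phi>(2) linear_inj_imp_surj[OF \<phi>(1,2)] by (simp add: bij_def)
  moreover have "\<phi> x = h x" if "x \<in> S" for x
    using linear_eq_on_span[OF \<phi>(1) h] \<phi>(3) that unfolding span_B[symmetric] by blast
  ultimately show thesis using that \<phi>(1) by blast
qed

lemma linear_factor_through_same_kernel:
  fixes F g :: "'a::euclidean_space \<Rightarrow> 'a"
  assumes F: "linear F" and g: "linear g" and ker: "{x. F x = 0} = {x. g x = 0}"
  obtains p where "linear p" "bij p" "\<And>x. g x = p (F x)"
proof -
  let ?K = "{x. F x = 0}"
  let ?C = "orthogonal_comp ?K"
  obtain L where L: "linear L" "\<forall>c\<in>?C. L (F c) = c"
    using linear_exists_left_inverse_on[OF F subspace_orthogonal_comp inj_on_orthogonal_comp_kernel[OF F]]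
    by blast
  have gLF: "g (L (F x)) = g x" for x
  proof -
    obtain k c where "F k = 0" "c \<in> ?C" "x = k + c"
      using kernel_plus_orthogonal_comp[OF F] .
    moreover have "g k = 0" using \<open>F k = 0\<close> ker by blast
    ultimately show ?thesis using L(2) linear_add[OF F] linear_add[OF g] by simp
  qed
  have gL: "linear (g \<circ> L)" using L(1) g by (rule linear_compose)
  have "inj_on (g \<circ> L) (range F)"
    unfolding linear_inj_on_iff_eq_0[OF gL linear_subspace_image[OF F subspace_UNIV]]
    using gLF ker by auto
  then obtain p where "linear p" "bij p" "\<And>y. y \<in> range F \<Longrightarrow> p y = (g \<circ> L) y"
    using linear_inj_on_extends_to_bij[OF gL linear_subspace_image[OF F subspace_UNIV]] by blast
  then show thesis using that gLF by auto
qed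

lemma linear_equivalent_if_dim_range_eq:
  fixes f g :: "'a::euclidean_space \<Rightarrow> 'a"
  assumes f: "linear f" and g: "linear g" and dim_eq: "dim (range f) = dim (range g)"
  obtains p q where "linear p" "bij p" "linear q" "bij q" "\<And>x. g x = p (f (q x))"
proof -
  let ?Kf = "{x. f x = 0}" and ?Kg = "{x. g x = 0}"
  txt \<open>Choose \<open>q\<close> carrying \<open>?Kg\<close> onto \<open>?Kf\<close>; then \<open>f \<circ> q\<close> and \<open>g\<close> have the same kernel.\<close>
  have "dim ?Kg = dim ?Kf"
    using dim_kernel_add_dim_range[OF f] dim_kernel_add_dim_range[OF g] dim_eq by simp
  then obtain h where h: "linear h" "h ` ?Kg = ?Kf" "inj_on h ?Kg"
    using subspace_isomorphism[OF linear_subspace_kernel[OF g] linear_subspace_kernel[OF f]] by blast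
  then obtain q where q: "linear q" "bij q" "\<And>x. x \<in> ?Kg \<Longrightarrow> q x = h x"
    using linear_inj_on_extends_to_bij[OF h(1) linear_subspace_kernel[OF g]] by blast
  have qK: "q ` ?Kg = ?Kf" using h(2) q(3) by (auto simp: image_iff)
  have "f (q x) = 0 \<longleftrightarrow> g x = 0" for x
  proof -
    have "f (q x) = 0 \<longleftrightarrow> q x \<in> q ` ?Kg" unfolding qK by simp
    also have "\<dots> \<longleftrightarrow> g x = 0" using inj_image_mem_iff[OF bij_is_inj[OF q(2)]] by simp
    finally show ?thesis .
  qed
  then have "{x. f (q x) = 0} = ?Kg" by simp
  then obtain p where "linear p" "bij p" "\<And>x. g x = p (f (q x))"
    using linear_factor_through_same_kernel[of "f \<circ> q" g] linear_compose[OF q(1) f] g by auto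
  then show thesis using that q(1,2) by blast
qed

lemma orthogonal_span_pair_iff:
  fixes u w v :: "'a::euclidean_space"
  shows "(\<forall>x\<in>span {u, w}. orthogonal x v) \<longleftrightarrow> u \<bullet> v = 0 \<and> w \<bullet> v = 0"
proof
  assume uw: "u \<bullet> v = 0 \<and> w \<bullet> v = 0"
  show "\<forall>x\<in>span {u, w}. orthogonal x v"
  proof
    fix x assume "x \<in> span {u, w}"
    then have "orthogonal v x"
      by (rule orthogonal_to_span) (use uw in \<open>auto simp: orthogonal_def inner_commute\<close>)
    then show "orthogonal x v" by (simp add: orthogonal_commute)
  qed
qed (simp add: span_base orthogonal_def)

lemma rank_add_dim_null_space:
  fixes A :: "real^'n::finite^'m::finite"
  shows "rank A + dim {x. A *v x = 0} = CARD('n)"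
  using dim_kernel_add_dim_range[OF matrix_vector_mul_linear[of A]] by (simp add: rank_dim_range DIM_cart)

lemma matrix_equivalent_if_rank_eq:
  fixes A B :: "real^'n::finite^'n"
  assumes "rank A = rank B"
  obtains P Q where "invertible P" "invertible Q" "B = P ** A ** Q"
proof -
  have "dim (range ((*v) A)) = dim (range ((*v) B))" using assms by (simp add: rank_dim_range)
  then obtain p q where pq: "linear p" "bij p" "linear q" "bij q" "\<And>x. B *v x = p (A *v q x)"
    by (rule linear_equivalent_if_dim_range_eq[OF matrix_vector_mul_linear matrix_vector_mul_linear]) iprover
  have "(*v) (matrix p) = p" "(*v) (matrix q) = q"
    using pq(1,3) by (simp_all add: fun_eq_iff matrix_works)
  then have "invertible (matrix p)" "invertible (matrix q)"
    unfolding invertible_eq_bij using pq(2,4) by simp_all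
  moreover have "B = matrix p ** A ** matrix q"
    unfolding matrix_eq using \<open>(*v) (matrix p) = p\<close> \<open>(*v) (matrix q) = q\<close>
    by (simp add: matrix_vector_mul_assoc[symmetric] pq(5))
  ultimately show thesis using that by blast
qed

lemma matrix_inv_unique:
  fixes A B :: "real^'m::finite^'m"
  assumes "A ** B = mat 1" "B ** A = mat 1"
  shows "matrix_inv A = B"
proof -
  have "\<exists>A'. A ** A' = mat 1 \<and> A' ** A = mat 1" using assms by blast
  then have inv: "matrix_inv A ** A = mat 1"
    unfolding matrix_inv_def by (rule someI2_ex) simp
  have "matrix_inv A = matrix_inv A ** (A ** B)"
    by (simp add: assms(1) matrix_mul_rid)
  also have "\<dots> = B"
    by (simp add: matrix_mul_assoc inv matrix_mul_lid)
  finally show ?thesis .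
qed

lemma invertible_matrix_inv:
  fixes S :: "real^'m::finite^'m"
  assumes "invertible S"
  shows "S ** matrix_inv S = mat 1" "matrix_inv S ** S = mat 1"
proof -
  obtain S' where "S ** S' = mat 1" "S' ** S = mat 1" using assms unfolding invertible_def by blast
  then show "S ** matrix_inv S = mat 1" "matrix_inv S ** S = mat 1" using matrix_inv_unique by auto
qed

lemma same_jnf_imp_rank_eq:
  fixes A B :: "real^'m::finite^'m"
  assumes "same_jnf A B"
  shows "rank A = rank B"
proof -
  obtain S where S: "invertible S" "B = S ** A ** matrix_inv S"
    using assms unfolding same_jnf_def by blast
  have "matrix_inv S ** B ** S = (matrix_inv S ** S) ** A ** (matrix_inv S ** S)"
    unfolding S(2) by (simp only: matrix_mul_assoc)
  then have "A = matrix_inv S ** B ** S"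
    by (simp add: invertible_matrix_inv[OF S(1)] matrix_mul_lid matrix_mul_rid)
  then have "rank A \<le> rank B" by (metis order_trans rank_mul_le_left rank_mul_le_right)
  moreover have "rank B \<le> rank A" using S(2) by (metis order_trans rank_mul_le_left rank_mul_le_right)
  ultimately show ?thesis by simp
qed

lemma matrix_vector_mult_axis_nth [simp]: "(A *v axis j 1) $ i = A $ i $ j" for A :: "real^'n::finite^'m"
  by (simp add: matrix_vector_mult_basis column_def)

section \<open>Block matrices on a doubled index type\<close>

lemma sum_UNIV_sum_type:
  "(\<Sum>c\<in>(UNIV::('a::finite + 'b::finite) set). g c) = (\<Sum>i\<in>UNIV. g (Inl i)) + (\<Sum>i\<in>UNIV. g (Inr i))"
  using sum.Plus[of "UNIV::'a set" "UNIV::'b set" g] by (simp add: UNIV_Plus_UNIV o_def)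

lemma all_sum_type: "(\<forall>c. Q c) \<longleftrightarrow> (\<forall>i. Q (Inl i)) \<and> (\<forall>i. Q (Inr i))"
  by (metis sum.exhaust)

definition ypart :: "real^('n::finite + 'n) \<Rightarrow> real^'n" where
  "ypart P = (\<chi> i. P $ Inr i)"

definition vec_of_parts :: "real^'n::finite \<Rightarrow> real^'n \<Rightarrow> real^('n + 'n)" where
  "vec_of_parts X Y = (\<chi> a. case a of Inl i \<Rightarrow> X$i | Inr i \<Rightarrow> Y$i)"

lemma parts_vec_of_parts [simp]: "xpart (vec_of_parts X Y) = X" "ypart (vec_of_parts X Y) = Y"
  by (simp_all add: vec_of_parts_def xpart_def ypart_def vec_eq_iff)

definition lower_left_block :: "real^'n::finite^'n \<Rightarrow> real^('n + 'n)^('n + 'n)" where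
  "lower_left_block A = (\<chi> a b. case (a, b) of (Inr i, Inl j) \<Rightarrow> A$i$j | _ \<Rightarrow> 0)"

definition upper_left_block :: "real^'n::finite^'n \<Rightarrow> real^('n + 'n)^('n + 'n)" where
  "upper_left_block A = (\<chi> a b. case (a, b) of (Inl i, Inl j) \<Rightarrow> A$i$j | _ \<Rightarrow> 0)"

definition block_diag :: "real^'n::finite^'n \<Rightarrow> real^'n^'n \<Rightarrow> real^('n + 'n)^('n + 'n)" where
  "block_diag X Y = (\<chi> a b. case (a, b) of (Inl i, Inl j) \<Rightarrow> X$i$j | (Inr i, Inr j) \<Rightarrow> Y$i$j | _ \<Rightarrow> 0)"

lemma lower_left_block_mult_vec: "lower_left_block A *v v = vec_of_parts 0 (A *v xpart v)"
  by (simp add: vec_eq_iff all_sum_type matrix_vector_mult_def lower_left_block_def vec_of_parts_def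
      xpart_def sum_UNIV_sum_type)

lemma lower_left_block_mult_lower_left_block: "lower_left_block A ** lower_left_block B = 0"
  by (simp add: vec_eq_iff all_sum_type matrix_matrix_mult_def lower_left_block_def sum_UNIV_sum_type)

lemma block_diag_mult: "block_diag X Y ** block_diag X' Y' = block_diag (X ** X') (Y ** Y')"
  by (simp add: vec_eq_iff all_sum_type matrix_matrix_mult_def block_diag_def sum_UNIV_sum_type)

lemma block_diag_one: "block_diag (mat 1) (mat 1) = mat 1"
  by (simp add: vec_eq_iff all_sum_type block_diag_def mat_def)

lemma block_diag_mult_lower_left_block: "block_diag X Y ** lower_left_block A = lower_left_block (Y ** A)"
  by (simp add: vec_eq_iff all_sum_type matrix_matrix_mult_def block_diag_def lower_left_block_def
      sum_UNIV_sum_type)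

lemma lower_left_block_mult_block_diag: "lower_left_block A ** block_diag X Y = lower_left_block (A ** X)"
  by (simp add: vec_eq_iff all_sum_type matrix_matrix_mult_def block_diag_def lower_left_block_def
      sum_UNIV_sum_type)

lemma rank_lower_left_block: "rank (lower_left_block A) = rank A"
proof -
  have "range (\<lambda>v. lower_left_block A *v v) = vec_of_parts 0 ` range (\<lambda>u. A *v u)"
    unfolding lower_left_block_mult_vec by (auto simp: image_iff) (metis parts_vec_of_parts(1))
  moreover have "dim (vec_of_parts 0 ` S) = dim S" for S :: "(real^'n) set"
  proof (rule dim_image_eq)
    show "linear (vec_of_parts 0 :: real^'n \<Rightarrow> _)"
      by (auto simp: linear_iff vec_of_parts_def vec_eq_iff split: sum.split)
    show "inj_on (vec_of_parts 0) (span S)"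
      by (metis inj_onI parts_vec_of_parts(2))
  qed
  ultimately show ?thesis by (simp add: rank_dim_range)
qed

lemma same_jnf_lower_left_block_iff:
  fixes A B :: "real^'n::finite^'n"
  shows "same_jnf (lower_left_block A) (lower_left_block B) \<longleftrightarrow> rank A = rank B"
proof
  assume "same_jnf (lower_left_block A) (lower_left_block B)"
  then show "rank A = rank B" by (metis same_jnf_imp_rank_eq rank_lower_left_block)
next
  assume "rank A = rank B"
  then obtain P Q where PQ: "invertible P" "invertible Q" "B = P ** A ** Q"
    by (rule matrix_equivalent_if_rank_eq)
  txt \<open>Conjugation by \<open>diag(Q\<^sup>-\<^sup>1, P)\<close> turns the block \<open>A\<close> into \<open>P A Q\<close>.\<close>
  let ?S = "block_diag (matrix_inv Q) P" and ?S' = "block_diag Q (matrix_inv P)"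
  have "?S ** ?S' = mat 1" "?S' ** ?S = mat 1"
    using invertible_matrix_inv[OF PQ(1)] invertible_matrix_inv[OF PQ(2)]
    by (simp_all add: block_diag_mult block_diag_one)
  then have "invertible ?S" "matrix_inv ?S = ?S'"
    unfolding invertible_def by (auto intro: matrix_inv_unique)
  moreover have "?S ** lower_left_block A ** ?S' = lower_left_block B"
    unfolding PQ(3) by (simp add: block_diag_mult_lower_left_block lower_left_block_mult_block_diag)
  ultimately show "same_jnf (lower_left_block A) (lower_left_block B)"
    unfolding same_jnf_def by metis
qed

section \<open>Curvature operators of a bilinear form\<close>

text \<open>For symmetric \<open>H\<close>, the Jacobi operator of \<open>X\<close> and the operator of the plane spanned
  by \<open>E1, E2\<close> of the algebraic curvature tensor \<open>H(Y,Z) H(X,W) - H(X,Z) H(Y,W)\<close>.\<close>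
definition curv_jacobi :: "real^'n::finite^'n \<Rightarrow> real^'n \<Rightarrow> real^'n^'n" where
  "curv_jacobi H X = (\<chi> i j. (X \<bullet> (H *v X)) * H$i$j - (H *v X)$i * (H *v X)$j)"

definition curv_plane :: "real^'n::finite^'n \<Rightarrow> real^'n \<Rightarrow> real^'n \<Rightarrow> real^'n^'n" where
  "curv_plane H E1 E2 = (\<chi> i j. (H *v E1)$i * (H *v E2)$j - (H *v E2)$i * (H *v E1)$j)"

lemma curv_jacobi_mult_vec:
  "curv_jacobi H X *v v = (X \<bullet> (H *v X)) *\<^sub>R (H *v v) - ((H *v X) \<bullet> v) *\<^sub>R (H *v X)"
proof -
  have "(\<chi> i j. c * H$i$j - a$i * a$j) *v v = c *\<^sub>R (H *v v) - (a \<bullet> v) *\<^sub>R a" for c a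
    by (simp add: vec_eq_iff matrix_vector_mult_def inner_vec_def sum_subtractf sum_distrib_left algebra_simps)
  then show ?thesis unfolding curv_jacobi_def .
qed

lemma curv_plane_mult_vec:
  "curv_plane H E1 E2 *v v = ((H *v E2) \<bullet> v) *\<^sub>R (H *v E1) - ((H *v E1) \<bullet> v) *\<^sub>R (H *v E2)"
proof -
  have "(\<chi> i j. a$i * b$j - b$i * a$j) *v v = (b \<bullet> v) *\<^sub>R a - (a \<bullet> v) *\<^sub>R b" for a b
    by (simp add: vec_eq_iff matrix_vector_mult_def inner_vec_def sum_subtractf sum_distrib_left algebra_simps)
  then show ?thesis unfolding curv_plane_def .
qed

lemma rank_curv_jacobi_non_null:
  fixes H :: "real^'n::finite^'n"
  assumes inj: "\<And>v. H *v v = 0 \<Longrightarrow> v = 0" and c: "X \<bullet> (H *v X) \<noteq> 0"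
  shows "rank (curv_jacobi H X) = CARD('n) - 1"
proof -
  let ?c = "X \<bullet> (H *v X)"
  have "{v. curv_jacobi H X *v v = 0} = span {X}"
  proof (intro subset_antisym subsetI)
    fix v assume "v \<in> {v. curv_jacobi H X *v v = 0}"
    then have "H *v (?c *\<^sub>R v - ((H *v X) \<bullet> v) *\<^sub>R X) = 0"
      by (simp add: curv_jacobi_mult_vec matrix_vector_mult_diff_distrib matrix_vector_mult_scaleR)
    then have "?c *\<^sub>R v = ((H *v X) \<bullet> v) *\<^sub>R X" using inj by fastforce
    then have "(1 / ?c) *\<^sub>R (?c *\<^sub>R v) = (((H *v X) \<bullet> v) / ?c) *\<^sub>R X" by simp
    then have "v = (((H *v X) \<bullet> v) / ?c) *\<^sub>R X" using c by simp
    then show "v \<in> span {X}" unfolding span_singleton by blast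
  next
    fix v assume "v \<in> span {X}"
    then show "v \<in> {v. curv_jacobi H X *v v = 0}"
      unfolding span_singleton
      by (auto simp: curv_jacobi_mult_vec matrix_vector_mult_scaleR inner_commute)
  qed
  moreover have "dim (span {X}) = 1" using c by auto
  ultimately show ?thesis using rank_add_dim_null_space[of "curv_jacobi H X"] by simp
qed

lemma rank_curv_jacobi_null:
  fixes H :: "real^'n::finite^'n"
  assumes HX: "H *v X \<noteq> 0" and c: "X \<bullet> (H *v X) = 0"
  shows "rank (curv_jacobi H X) = 1"
proof -
  have "{v. curv_jacobi H X *v v = 0} = {v. (H *v X) \<bullet> v = 0}"
    using HX c by (auto simp: curv_jacobi_mult_vec)
  moreover have "dim {v. (H *v X) \<bullet> v = 0} = CARD('n) - 1"
    using dim_hyperplane[OF HX] by (simp add: DIM_cart)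
  ultimately have "rank (curv_jacobi H X) + (CARD('n) - 1) = CARD('n)"
    using rank_add_dim_null_space[of "curv_jacobi H X"] by simp
  moreover have "CARD('n) > 0" by simp
  ultimately show ?thesis by linarith
qed

lemma curv_jacobi_eq_0: "H *v X = 0 \<Longrightarrow> curv_jacobi H X = 0"
  unfolding matrix_eq by (simp add: curv_jacobi_mult_vec)

lemma curv_jacobi_neq_0:
  assumes "X \<bullet> (H *v X) > 0" and "w \<bullet> (H *v w) < 0"
  shows "curv_jacobi H X \<noteq> 0"
proof
  assume "curv_jacobi H X = 0"
  then have "w \<bullet> (curv_jacobi H X *v w) = 0" by simp
  moreover have "w \<bullet> (curv_jacobi H X *v w) = (X \<bullet> (H *v X)) * (w \<bullet> (H *v w)) - ((H *v X) \<bullet> w)\<^sup>2"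
    by (simp add: curv_jacobi_mult_vec inner_diff_right inner_commute power2_eq_square)
  moreover have "(X \<bullet> (H *v X)) * (w \<bullet> (H *v w)) < 0" using assms by (simp add: mult_pos_neg)
  ultimately show False by (smt (verit) zero_le_power2)
qed

lemma indefinite_form_has_null_vector:
  fixes H :: "real^'n::finite^'n"
  assumes v: "v \<bullet> (H *v v) > 0" and w: "w \<bullet> (H *v w) < 0"
  obtains X where "X \<noteq> 0" "X \<bullet> (H *v X) = 0"
proof -
  define A where "A = v \<bullet> (H *v v)"
  define B where "B = (v \<bullet> (H *v w) + w \<bullet> (H *v v)) / 2"
  define C where "C = w \<bullet> (H *v w)"
  define D where "D = B\<^sup>2 - A * C"
  have "D \<ge> 0" using v w unfolding D_def A_def C_def by (smt (verit) mult_pos_neg zero_le_power2)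
  then have sqrt_D: "sqrt D * sqrt D = D" by simp
  have C: "C \<noteq> 0" using w C_def by simp
  txt \<open>\<open>t\<close> is a root of \<open>A + 2 t B + t\<^sup>2 C\<close>, the value of the form at \<open>v + t w\<close>.\<close>
  define t where "t = (sqrt D - B) / C"
  have "(v + t *\<^sub>R w) \<bullet> (H *v (v + t *\<^sub>R w)) = A + 2 * t * B + t * t * C"
    unfolding A_def B_def C_def
    by (simp add: matrix_vector_right_distrib matrix_vector_mult_scaleR inner_add_left inner_add_right
        algebra_simps)
  also have "\<dots> = 0"
  proof -
    have "C * (A + 2 * t * B + t * t * C) = sqrt D * sqrt D - B\<^sup>2 + A * C"
      unfolding t_def using C by (simp add: field_simps power2_eq_square)
    then show ?thesis using sqrt_D C unfolding D_def by simp
  qed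
  finally have null: "(v + t *\<^sub>R w) \<bullet> (H *v (v + t *\<^sub>R w)) = 0" .
  have "v + t *\<^sub>R w \<noteq> 0"
  proof
    assume "v + t *\<^sub>R w = 0"
    then have "v = (- t) *\<^sub>R w" by (simp add: eq_neg_iff_add_eq_0 add.commute)
    then have "v \<bullet> (H *v v) = (- t) * (- t) * (w \<bullet> (H *v w))"
      by (simp only: matrix_vector_mult_scaleR inner_scaleR_left inner_scaleR_right mult.assoc)
    moreover have "t * t * (w \<bullet> (H *v w)) \<le> 0" using w by (simp add: mult_nonneg_nonpos)
    ultimately show False using v by simp
  qed
  with null show thesis using that by blast
qed

lemma curv_jacobi_ranks_differ_if_indefinite:
  fixes H :: "real^'n::finite^'n"
  assumes card: "CARD('n) \<ge> 3" and indef: "indefinite_mat H"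
  obtains X1 X2 where "X1 \<noteq> 0" "X2 \<noteq> 0" "rank (curv_jacobi H X1) \<noteq> rank (curv_jacobi H X2)"
proof -
  obtain v w where v: "v \<bullet> (H *v v) > 0" and w: "w \<bullet> (H *v w) < 0"
    using indef unfolding indefinite_mat_def by blast
  have "v \<noteq> 0" using v by auto
  show thesis
  proof (cases "\<exists>X0. X0 \<noteq> 0 \<and> H *v X0 = 0")
    case True
    then obtain X0 where "X0 \<noteq> 0" "H *v X0 = 0" by blast
    moreover have "rank (curv_jacobi H v) \<noteq> 0" using curv_jacobi_neq_0[OF v w] rank_eq_0 by blast
    ultimately show thesis using that \<open>v \<noteq> 0\<close> curv_jacobi_eq_0 by force
  next
    case False
    then have inj: "\<And>u. H *v u = 0 \<Longrightarrow> u = 0" by blast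
    obtain X where X: "X \<noteq> 0" "X \<bullet> (H *v X) = 0"
      using indefinite_form_has_null_vector[OF v w] by blast
    have "rank (curv_jacobi H X) = 1" using rank_curv_jacobi_null inj X by blast
    moreover have "rank (curv_jacobi H v) = CARD('n) - 1" using rank_curv_jacobi_non_null[OF inj] v by simp
    ultimately show thesis using that X(1) \<open>v \<noteq> 0\<close> card by force
  qed
qed

lemma rank_curv_plane:
  fixes H :: "real^'n::finite^'n"
  assumes indep: "\<And>a b. a *\<^sub>R (H *v E1) + b *\<^sub>R (H *v E2) = 0 \<Longrightarrow> a = 0 \<and> b = 0"
  shows "rank (curv_plane H E1 E2) = 2"
proof -
  let ?u = "H *v E1" and ?w = "H *v E2"
  have "?u \<noteq> ?w" "?w \<noteq> 0" using indep[of 1 "-1"] indep[of 0 1] by auto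
  moreover have "?u \<notin> span {?w}"
  proof
    assume "?u \<in> span {?w}"
    then obtain k where "?u = k *\<^sub>R ?w" unfolding span_singleton by blast
    then show False using indep[of 1 "- k"] by simp
  qed
  ultimately have "independent {?u, ?w}" by (simp add: independent_insert)
  then have dim_uw: "dim (span {?u, ?w}) = 2"
    using \<open>?u \<noteq> ?w\<close> by (simp only: dim_span_eq_card_independent[OF \<open>independent {?u, ?w}\<close>]) simp
  have "curv_plane H E1 E2 *v v = 0 \<longleftrightarrow> (\<forall>x\<in>span {?u, ?w}. orthogonal x v)" for v
    unfolding orthogonal_span_pair_iff
    using indep[of "- (?w \<bullet> v)" "?u \<bullet> v"] by (auto simp: curv_plane_mult_vec algebra_simps)
  then have "{v. curv_plane H E1 E2 *v v = 0} = {v \<in> UNIV. \<forall>x\<in>span {?u, ?w}. orthogonal x v}"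
    by blast
  moreover have "dim {v \<in> UNIV. \<forall>x\<in>span {?u, ?w}. orthogonal x v} + 2 = CARD('n)"
    using dim_subspace_orthogonal_to_vectors[of "span {?u, ?w}" UNIV] dim_uw
    by (simp add: dim_UNIV DIM_cart)
  ultimately show ?thesis using rank_add_dim_null_space[of "curv_plane H E1 E2"] by simp
qed

lemma definite_mat_non_null: "definite_mat H \<Longrightarrow> v \<noteq> 0 \<Longrightarrow> v \<bullet> (H *v v) \<noteq> 0"
  unfolding definite_mat_def by (metis less_irrefl)

lemma definite_mat_inj: "definite_mat H \<Longrightarrow> H *v v = 0 \<Longrightarrow> v = 0"
  using definite_mat_non_null by fastforce

lemma nondegenerate_mat_inj: "nondegenerate_mat H \<Longrightarrow> H *v v = 0 \<Longrightarrow> v = 0"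
  unfolding nondegenerate_mat_def
  by (metis invertible_det_nz invertible_eq_bij bij_is_inj injD matrix_vector_mult_0_right)

section \<open>Partial derivatives\<close>

lemma has_real_derivative_along_line:
  fixes F :: "real^'m::finite \<Rightarrow> real"
  assumes "F differentiable (at (y + t *\<^sub>R v))"
  shows "((\<lambda>s. F (y + s *\<^sub>R v)) has_real_derivative frechet_derivative F (at (y + t *\<^sub>R v)) v) (at t)"
proof -
  let ?D = "frechet_derivative F (at (y + t *\<^sub>R v))"
  have D: "(F has_derivative ?D) (at ((\<lambda>s. y + s *\<^sub>R v) t))"
    using assms frechet_derivative_works by auto
  have "((\<lambda>s. y + s *\<^sub>R v) has_derivative (\<lambda>s. s *\<^sub>R v)) (at t)"
    by (auto intro!: derivative_eq_intros)
  from diff_chain_at[OF this D]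
  have "((\<lambda>s. F (y + s *\<^sub>R v)) has_derivative (\<lambda>s. ?D (s *\<^sub>R v))) (at t)"
    by (simp add: o_def)
  moreover have "(\<lambda>s. ?D (s *\<^sub>R v)) = (*) (?D v)"
    using has_derivative_linear[OF D] by (auto simp: linear_scale)
  ultimately show ?thesis by (simp add: has_field_derivative_def)
qed

lemma pd_eq_frechet_derivative:
  fixes F :: "real^'m::finite \<Rightarrow> real"
  assumes "F differentiable (at y)"
  shows "pd k F y = frechet_derivative F (at y) (axis k 1)"
  using has_real_derivative_along_line[of F y 0 "axis k 1"] assms
  unfolding pd_def by (simp add: DERIV_imp_deriv)

lemma has_real_derivative_pd:
  fixes F :: "real^'m::finite \<Rightarrow> real"
  assumes "F differentiable (at (y + t *\<^sub>R axis k 1))"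
  shows "((\<lambda>s. F (y + s *\<^sub>R axis k 1)) has_real_derivative pd k F (y + t *\<^sub>R axis k 1)) (at t)"
  using has_real_derivative_along_line[OF assms] pd_eq_frechet_derivative[OF assms] by simp

lemma pd_mult:
  fixes A B :: "real^'m::finite \<Rightarrow> real"
  assumes "A differentiable (at y)" "B differentiable (at y)"
  shows "pd k (\<lambda>x. A x * B x) y = pd k A y * B y + A y * pd k B y"
proof -
  have "((\<lambda>s. A (y + s *\<^sub>R axis k 1) * B (y + s *\<^sub>R axis k 1)) has_real_derivative
          pd k A y * B y + pd k B y * A y) (at 0)"
    using DERIV_mult[OF has_real_derivative_pd has_real_derivative_pd, of A y 0 k B] assms by simp
  then show ?thesis unfolding pd_def by (simp add: DERIV_imp_deriv algebra_simps)
qed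

lemma pd_const [simp]: "pd k (\<lambda>x. c) y = 0"
  unfolding pd_def by simp

lemma smooth_fun_differentiable: "smooth_fun F \<Longrightarrow> F differentiable (at x)"
  unfolding smooth_fun_def by (metis iter_pd.simps(1))

lemma smooth_fun_pd: "smooth_fun F \<Longrightarrow> smooth_fun (pd k F)"
proof -
  have "iter_pd ks (pd k F) = iter_pd (ks @ [k]) F" for ks
    by (induction ks) auto
  then show "smooth_fun F \<Longrightarrow> smooth_fun (pd k F)" unfolding smooth_fun_def by metis
qed

lemma second_difference_mean_value:
  fixes F :: "real^'m::finite \<Rightarrow> real"
  assumes "smooth_fun F" and h: "h > 0"
  obtains \<xi> \<eta> where "0 < \<xi>" "\<xi> < h" "0 < \<eta>" "\<eta> < h"
    "F (x + h *\<^sub>R axis k 1 + h *\<^sub>R axis l 1) - F (x + h *\<^sub>R axis k 1) - F (x + h *\<^sub>R axis l 1) + F x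
       = h * h * pd l (pd k F) (x + \<xi> *\<^sub>R axis k 1 + \<eta> *\<^sub>R axis l 1)"
proof -
  let ?e = "axis k 1 :: real^'m" and ?d = "axis l 1 :: real^'m"
  note diff = smooth_fun_differentiable[OF assms(1)] smooth_fun_differentiable[OF smooth_fun_pd[OF assms(1)]]
  define \<phi> where "\<phi> s = F ((x + h *\<^sub>R ?d) + s *\<^sub>R ?e) - F (x + s *\<^sub>R ?e)" for s
  have "(\<phi> has_real_derivative (pd k F ((x + h *\<^sub>R ?d) + s *\<^sub>R ?e) - pd k F (x + s *\<^sub>R ?e))) (at s)" for s
    unfolding \<phi>_def by (intro DERIV_diff has_real_derivative_pd diff)
  from MVT2[OF h this] obtain \<xi> where \<xi>: "0 < \<xi>" "\<xi> < h"
    "\<phi> h - \<phi> 0 = (h - 0) * (pd k F ((x + h *\<^sub>R ?d) + \<xi> *\<^sub>R ?e) - pd k F (x + \<xi> *\<^sub>R ?e))"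
    by blast
  define \<psi> where "\<psi> t = pd k F ((x + \<xi> *\<^sub>R ?e) + t *\<^sub>R ?d)" for t
  have "(\<psi> has_real_derivative pd l (pd k F) ((x + \<xi> *\<^sub>R ?e) + t *\<^sub>R ?d)) (at t)" for t
    unfolding \<psi>_def by (intro has_real_derivative_pd diff)
  from MVT2[OF h this] obtain \<eta> where \<eta>: "0 < \<eta>" "\<eta> < h"
    "\<psi> h - \<psi> 0 = (h - 0) * pd l (pd k F) ((x + \<xi> *\<^sub>R ?e) + \<eta> *\<^sub>R ?d)"
    by blast
  have "F (x + h *\<^sub>R ?e + h *\<^sub>R ?d) - F (x + h *\<^sub>R ?e) - F (x + h *\<^sub>R ?d) + F x = \<phi> h - \<phi> 0"
    unfolding \<phi>_def by (simp add: algebra_simps)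
  also have "\<dots> = h * (\<psi> h - \<psi> 0)"
    using \<xi>(3) unfolding \<psi>_def by (simp add: algebra_simps)
  also have "\<dots> = h * h * pd l (pd k F) (x + \<xi> *\<^sub>R ?e + \<eta> *\<^sub>R ?d)"
    using \<eta>(3) by simp
  finally show thesis using that \<xi>(1,2) \<eta>(1,2) by blast
qed

lemma dist_add_two_axes_less:
  fixes x :: "real^'m::finite"
  assumes "0 < a" "a < h" "0 < b" "b < h"
  shows "dist (x + a *\<^sub>R axis k 1 + b *\<^sub>R axis l 1) x < 2 * h"
proof -
  have "dist (x + a *\<^sub>R axis k 1 + b *\<^sub>R axis l 1) x
      \<le> norm (a *\<^sub>R axis k 1 :: real^'m) + norm (b *\<^sub>R axis l 1 :: real^'m)"
    unfolding dist_norm by (simp add: add.assoc norm_triangle_ineq del: norm_scaleR)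
  then show ?thesis using assms by simp
qed

text \<open>Both mixed partials are values of continuous functions at points near \<open>x\<close>, and these
  values agree: each equals the same second difference divided by \<open>h\<^sup>2\<close>.\<close>
lemma mixed_pd_close:
  fixes F :: "real^'m::finite \<Rightarrow> real"
  assumes F: "smooth_fun F" and \<epsilon>: "\<epsilon> > 0"
  shows "\<bar>pd j (pd i F) x - pd i (pd j F) x\<bar> \<le> 2 * \<epsilon>"
proof -
  let ?A = "pd j (pd i F)" and ?B = "pd i (pd j F)"
  have "isCont ?A x" "isCont ?B x"
    using smooth_fun_differentiable[OF smooth_fun_pd[OF smooth_fun_pd[OF F]]]
    by (simp_all add: differentiable_imp_continuous_within)
  then obtain dA dB where d: "dA > 0" "dB > 0"
    "\<And>y. dist y x < dA \<Longrightarrow> dist (?A y) (?A x) < \<epsilon>" "\<And>y. dist y x < dB \<Longrightarrow> dist (?B y) (?B x) < \<epsilon>"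
    using \<epsilon> unfolding continuous_at_eps_delta by blast
  define h where "h = min dA dB / 2"
  have h: "h > 0" using d unfolding h_def by simp
  obtain \<xi> \<eta> where 1: "0 < \<xi>" "\<xi> < h" "0 < \<eta>" "\<eta> < h"
    "F (x + h *\<^sub>R axis i 1 + h *\<^sub>R axis j 1) - F (x + h *\<^sub>R axis i 1) - F (x + h *\<^sub>R axis j 1) + F x
       = h * h * ?A (x + \<xi> *\<^sub>R axis i 1 + \<eta> *\<^sub>R axis j 1)"
    using second_difference_mean_value[OF F h] by blast
  obtain \<xi>' \<eta>' where 2: "0 < \<xi>'" "\<xi>' < h" "0 < \<eta>'" "\<eta>' < h"
    "F (x + h *\<^sub>R axis j 1 + h *\<^sub>R axis i 1) - F (x + h *\<^sub>R axis j 1) - F (x + h *\<^sub>R axis i 1) + F x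
       = h * h * ?B (x + \<xi>' *\<^sub>R axis j 1 + \<eta>' *\<^sub>R axis i 1)"
    using second_difference_mean_value[OF F h] by blast
  have "x + h *\<^sub>R axis j 1 + h *\<^sub>R axis i 1 = x + h *\<^sub>R axis i 1 + h *\<^sub>R axis j 1"
    by (simp add: algebra_simps)
  then have "h * h * ?A (x + \<xi> *\<^sub>R axis i 1 + \<eta> *\<^sub>R axis j 1)
      = h * h * ?B (x + \<xi>' *\<^sub>R axis j 1 + \<eta>' *\<^sub>R axis i 1)"
    using 1(5) 2(5) by (smt (verit))
  then have "?A (x + \<xi> *\<^sub>R axis i 1 + \<eta> *\<^sub>R axis j 1) = ?B (x + \<xi>' *\<^sub>R axis j 1 + \<eta>' *\<^sub>R axis i 1)"
    using h by simp
  moreover have "\<bar>?A (x + \<xi> *\<^sub>R axis i 1 + \<eta> *\<^sub>R axis j 1) - ?A x\<bar> < \<epsilon>"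
    using d(3) dist_add_two_axes_less[OF 1(1-4), of x i j] unfolding h_def by (simp add: dist_real_def)
  moreover have "\<bar>?B (x + \<xi>' *\<^sub>R axis j 1 + \<eta>' *\<^sub>R axis i 1) - ?B x\<bar> < \<epsilon>"
    using d(4) dist_add_two_axes_less[OF 2(1-4), of x j i] unfolding h_def by (simp add: dist_real_def)
  ultimately show ?thesis by linarith
qed

lemma pd_commute:
  fixes F :: "real^'m::finite \<Rightarrow> real"
  assumes "smooth_fun F"
  shows "pd i (pd j F) x = pd j (pd i F) x"
proof -
  have "\<bar>pd j (pd i F) x - pd i (pd j F) x\<bar> \<le> 0 + \<epsilon>" if "\<epsilon> > 0" for \<epsilon>
    using mixed_pd_close[OF assms, of "\<epsilon> / 2"] that by simp
  then have "\<bar>pd j (pd i F) x - pd i (pd j F) x\<bar> \<le> 0" by (rule field_le_epsilon)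
  then show ?thesis by simp
qed

section \<open>The metric \<open>g\<^sub>f\<close> and its curvature\<close>

definition gf_inv :: "(real^'n::finite \<Rightarrow> real) \<Rightarrow> real^('n+'n) \<Rightarrow> real^('n+'n)^('n+'n)" where
  "gf_inv f P = (\<chi> a b. case (a, b) of
      (Inl i, Inl j) \<Rightarrow> 0
    | (Inl i, Inr j) \<Rightarrow> (if i = j then 1 else 0)
    | (Inr i, Inl j) \<Rightarrow> (if i = j then 1 else 0)
    | (Inr i, Inr j) \<Rightarrow> - (pd i f (xpart P) * pd j f (xpart P)))"

lemma matrix_inv_gmat_gf: "matrix_inv (gmat (gf f) P) = gf_inv f P"
proof (rule matrix_inv_unique)
  show "gmat (gf f) P ** gf_inv f P = mat 1" "gf_inv f P ** gmat (gf f) P = mat 1"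
    unfolding matrix_matrix_mult_def
    by (simp_all add: vec_eq_iff all_sum_type mat_def gmat_def gf_inv_def gf_def sum_UNIV_sum_type)
      (auto simp: mult.commute[of "if _ then _ else _"] if_distrib[of "\<lambda>x. _ * x"] sum_negf cong: if_cong)
qed

lemma ginv_gf: "ginv (gf f) P a b = gf_inv f P $ a $ b"
  unfolding ginv_def matrix_inv_gmat_gf ..

lemma xpart_add_axis:
  "xpart (P + t *\<^sub>R axis (Inl i) 1) = xpart P + t *\<^sub>R axis i 1"
  "xpart (P + t *\<^sub>R axis (Inr i) 1) = xpart P"
  by (simp_all add: xpart_def vec_eq_iff axis_def)

lemma xpart_axis [simp]: "xpart (axis (Inl i) 1) = axis i 1" "xpart (axis (Inr i) 1) = 0"
  by (simp_all add: xpart_def vec_eq_iff axis_def)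

lemma pd_comp_xpart:
  "pd (Inl i) (\<lambda>Q. G (xpart Q)) P = pd i G (xpart P)"
  "pd (Inr i) (\<lambda>Q. G (xpart Q)) P = 0"
  unfolding pd_def xpart_add_axis by simp_all

lemma pd_gf_xxx:
  assumes f: "smooth_fun f"
  shows "pd (Inl i) (\<lambda>Q. gf f Q (Inl j) (Inl k)) P
     = pd i (pd j f) (xpart P) * pd k f (xpart P) + pd j f (xpart P) * pd i (pd k f) (xpart P)"
proof -
  have "(\<lambda>Q. gf f Q (Inl j) (Inl k)) = (\<lambda>Q. (\<lambda>x. pd j f x * pd k f x) (xpart Q))"
    by (simp add: gf_def)
  then show ?thesis
    using pd_comp_xpart(1)[of i "\<lambda>x. pd j f x * pd k f x" P]
    by (simp add: pd_mult smooth_fun_differentiable[OF smooth_fun_pd[OF f]])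
qed

lemma pd_gf_eq_0:
  assumes "\<not> (\<exists>i j k. a = Inl i \<and> b = Inl j \<and> c = Inl k)"
  shows "pd a (\<lambda>Q. gf f Q b c) P = 0"
proof (cases "\<exists>j k. b = Inl j \<and> c = Inl k")
  case True
  then obtain i j k where "a = Inr i" "b = Inl j" "c = Inl k" using assms by (cases a) auto
  moreover have "(\<lambda>Q. gf f Q (Inl j) (Inl k)) = (\<lambda>Q. (\<lambda>x. pd j f x * pd k f x) (xpart Q))"
    by (simp add: gf_def)
  ultimately show ?thesis using pd_comp_xpart(2)[of i "\<lambda>x. pd j f x * pd k f x" P] by simp
next
  case False
  then have "(\<lambda>Q. gf f Q b c) = (\<lambda>Q. gf f 0 b c)"
    by (cases b; cases c) (auto simp: gf_def)
  then show ?thesis by simp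
qed

text \<open>Selectors for the index patterns \<open>(x, x, x)\<close> and \<open>(x, x, y)\<close>: only these carry nonzero
  Christoffel symbols and curvature components of \<open>g\<^sub>f\<close>.\<close>
definition case_xxx :: "('n + 'n) \<Rightarrow> ('n + 'n) \<Rightarrow> ('n + 'n) \<Rightarrow> ('n \<Rightarrow> 'n \<Rightarrow> 'n \<Rightarrow> real) \<Rightarrow> real" where
  "case_xxx a b c g = (case (a, b, c) of (Inl i, Inl j, Inl k) \<Rightarrow> g i j k | _ \<Rightarrow> 0)"

definition case_xxy :: "('n + 'n) \<Rightarrow> ('n + 'n) \<Rightarrow> ('n + 'n) \<Rightarrow> ('n \<Rightarrow> 'n \<Rightarrow> 'n \<Rightarrow> real) \<Rightarrow> real" where
  "case_xxy a b c g = (case (a, b, c) of (Inl i, Inl j, Inr k) \<Rightarrow> g i j k | _ \<Rightarrow> 0)"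

lemma case_xxx_simps [simp]:
  "case_xxx (Inl i) (Inl j) (Inl k) g = g i j k"
  "case_xxx (Inr i) b c g = 0" "case_xxx a (Inr j) c g = 0" "case_xxx a b (Inr k) g = 0"
  unfolding case_xxx_def by (auto split: sum.split)

lemma case_xxy_simps [simp]:
  "case_xxy (Inl i) (Inl j) (Inr k) g = g i j k"
  "case_xxy (Inr i) b c g = 0" "case_xxy a (Inr j) c g = 0" "case_xxy a b (Inl k) g = 0"
  unfolding case_xxy_def by (auto split: sum.split)

lemma chr1_gf:
  assumes f: "smooth_fun f"
  shows "chr1 (gf f) P a b c = case_xxx a b c (\<lambda>i j k. pd i (pd j f) (xpart P) * pd k f (xpart P))"
proof (cases "\<exists>i j k. a = Inl i \<and> b = Inl j \<and> c = Inl k")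
  case True
  then obtain i j k where "a = Inl i" "b = Inl j" "c = Inl k" by blast
  then show ?thesis unfolding chr1_def
    by (simp add: pd_gf_xxx[OF f] pd_commute[OF f, of k i] pd_commute[OF f, of k j]
        pd_commute[OF f, of j i] algebra_simps)
next
  case False
  have "pd a (\<lambda>Q. gf f Q b c) P = 0" "pd b (\<lambda>Q. gf f Q a c) P = 0" "pd c (\<lambda>Q. gf f Q a b) P = 0"
    by (rule pd_gf_eq_0; use False in blast)+
  moreover have "case_xxx a b c g = 0" for g using False by (cases a; cases b; cases c) auto
  ultimately show ?thesis unfolding chr1_def by simp
qed

lemma chr_gf:
  assumes f: "smooth_fun f"
  shows "chr (gf f) P a b l = case_xxy a b l (\<lambda>i j k. pd i (pd j f) (xpart P) * pd k f (xpart P))"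
  unfolding chr_def chr1_gf[OF f] ginv_gf sum_UNIV_sum_type
  by (cases a; cases b; cases l) (auto simp: gf_inv_def if_distrib[of "\<lambda>x. x * _"] cong: if_cong)

lemma pd_chr_gf:
  assumes f: "smooth_fun f"
  shows "pd a (\<lambda>Q. chr (gf f) Q b c l) P = (case a of
      Inl i \<Rightarrow> case_xxy b c l (\<lambda>j k m. pd i (pd j (pd k f)) (xpart P) * pd m f (xpart P)
                                    + pd j (pd k f) (xpart P) * pd i (pd m f) (xpart P))
    | Inr _ \<Rightarrow> 0)"
proof (cases "\<exists>j k m. b = Inl j \<and> c = Inl k \<and> l = Inr m")
  case True
  then obtain j k m where bcl: "b = Inl j" "c = Inl k" "l = Inr m" by blast
  let ?G = "\<lambda>x. pd j (pd k f) x * pd m f x"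
  have "(\<lambda>Q. chr (gf f) Q b c l) = (\<lambda>Q. ?G (xpart Q))"
    using bcl by (simp add: chr_gf[OF f])
  then show ?thesis
    using bcl pd_comp_xpart[of _ ?G P] smooth_fun_differentiable[OF smooth_fun_pd[OF f]]
      smooth_fun_differentiable[OF smooth_fun_pd[OF smooth_fun_pd[OF f]]]
    by (cases a) (simp_all add: pd_mult)
next
  case False
  then have "case_xxy b c l g = 0" for g by (cases b; cases c; cases l) auto
  then show ?thesis by (simp add: chr_gf[OF f] split: sum.split)
qed

lemma Rup_gf:
  assumes f: "smooth_fun f"
  shows "Rup (gf f) P a b c l = case_xxx a b c (\<lambda>i j k. case l of
      Inr m \<Rightarrow> pd j (pd k f) (xpart P) * pd i (pd m f) (xpart P) - pd i (pd k f) (xpart P) * pd j (pd m f) (xpart P)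
    | Inl _ \<Rightarrow> 0)"
proof -
  have "chr (gf f) P b c m * chr (gf f) P a m l - chr (gf f) P a c m * chr (gf f) P b m l = 0" for m
    by (cases m) (simp_all add: chr_gf[OF f])
  then show ?thesis unfolding Rup_def pd_chr_gf[OF f]
    by (cases a; cases b; cases c; cases l)
      (simp_all add: pd_commute[OF smooth_fun_pd[OF f], of _ _ _ "xpart P"] algebra_simps)
qed

lemma Rcoord_gf:
  assumes f: "smooth_fun f"
  shows "Rcoord (gf f) P a b c d = case_xxx a b c (\<lambda>i j k. case d of
      Inl l \<Rightarrow> pd j (pd k f) (xpart P) * pd i (pd l f) (xpart P) - pd i (pd k f) (xpart P) * pd j (pd l f) (xpart P)
    | Inr _ \<Rightarrow> 0)"
  unfolding Rcoord_def Rup_gf[OF f] sum_UNIV_sum_type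
  by (cases a; cases b; cases c; cases d) (simp_all add: gf_def if_distrib[of "\<lambda>x. _ * x"] cong: if_cong)

lemma inner_hess: "u \<bullet> (hess f p *v v) = (\<Sum>i\<in>UNIV. \<Sum>j\<in>UNIV. u$i * v$j * pd i (pd j f) p)"
  by (simp add: inner_vec_def matrix_vector_mult_def hess_def sum_distrib_left algebra_simps)

lemma curv_gf:
  assumes f: "smooth_fun f"
  shows "curv (gf f) P x y z w =
      (xpart y \<bullet> (hess f (xpart P) *v xpart z)) * (xpart x \<bullet> (hess f (xpart P) *v xpart w))
    - (xpart x \<bullet> (hess f (xpart P) *v xpart z)) * (xpart y \<bullet> (hess f (xpart P) *v xpart w))"
proof -
  let ?D = "\<lambda>i j. pd i (pd j f) (xpart P)"
  let ?X = "xpart x" and ?Y = "xpart y" and ?Z = "xpart z" and ?W = "xpart w"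
  have "curv (gf f) P x y z w = (\<Sum>i\<in>UNIV. \<Sum>j\<in>UNIV. \<Sum>k\<in>UNIV. \<Sum>l\<in>UNIV.
      ?X$i * ?Y$j * ?Z$k * ?W$l * (?D j k * ?D i l - ?D i k * ?D j l))"
    unfolding curv_def Rcoord_gf[OF f] sum_UNIV_sum_type by (simp add: xpart_def)
  also have "\<dots> = (\<Sum>j\<in>UNIV. \<Sum>i\<in>UNIV. \<Sum>k\<in>UNIV. \<Sum>l\<in>UNIV. ?X$i * ?Y$j * ?Z$k * ?W$l * ?D j k * ?D i l)
     - (\<Sum>i\<in>UNIV. \<Sum>j\<in>UNIV. \<Sum>k\<in>UNIV. \<Sum>l\<in>UNIV. ?X$i * ?Y$j * ?Z$k * ?W$l * ?D i k * ?D j l)"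
    by (subst sum.swap) (simp add: sum_subtractf algebra_simps)
  also have "\<dots> = (?Y \<bullet> (hess f (xpart P) *v ?Z)) * (?X \<bullet> (hess f (xpart P) *v ?W))
     - (?X \<bullet> (hess f (xpart P) *v ?Z)) * (?Y \<bullet> (hess f (xpart P) *v ?W))"
    unfolding inner_hess by (simp add: sum_distrib_left sum_distrib_right algebra_simps)
  finally show ?thesis .
qed

lemma ricci_gf: "smooth_fun f \<Longrightarrow> ricci (gf f) P x y = 0"
  unfolding ricci_def
proof (intro sum.neutral ballI)
  fix a b assume "smooth_fun f"
  then show "ginv (gf f) P a b * curv (gf f) P x (axis a 1) (axis b 1) y = 0"
    by (cases a; cases b) (simp_all add: ginv_gf gf_inv_def curv_gf)
qed

lemma weyl_gf: "smooth_fun f \<Longrightarrow> weyl (gf f) P x y z w = curv (gf f) P x y z w"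
  by (simp add: weyl_def scal_def ricci_gf)

definition grad :: "(real^'n::finite \<Rightarrow> real) \<Rightarrow> real^'n \<Rightarrow> real^'n" where
  "grad f p = (\<chi> i. pd i f p)"

lemma gform_gf:
  "gform (gf f) P x y = (xpart x \<bullet> grad f (xpart P)) * (xpart y \<bullet> grad f (xpart P))
     + xpart x \<bullet> ypart y + ypart x \<bullet> xpart y"
  unfolding gform_def sum_UNIV_sum_type
  by (simp add: gf_def xpart_def ypart_def grad_def inner_vec_def sum_product if_distrib[of "\<lambda>x. _ * x"]
      algebra_simps sum.distrib cong: if_cong)

lemma xpart_neq_0_if_non_null: "gform (gf f) P x x \<noteq> 0 \<Longrightarrow> xpart x \<noteq> 0"
  by (auto simp: gform_gf)

lemma exists_gf_vector_with_xpart: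
  fixes X :: "real^'n::finite"
  assumes "X \<noteq> 0"
  obtains x where "xpart x = X" "gform (gf f) P x x = \<epsilon>"
proof -
  txt \<open>The \<open>y\<close>-part \<open>s X\<close> only enters through \<open>2 s X \<bullet> X\<close>, which can take any value.\<close>
  define s where "s = (\<epsilon> - (X \<bullet> grad f (xpart P))\<^sup>2) / 2 / (X \<bullet> X)"
  have "X \<bullet> X \<noteq> 0" using assms by simp
  then have "X \<bullet> (s *\<^sub>R X) = (\<epsilon> - (X \<bullet> grad f (xpart P))\<^sup>2) / 2" unfolding s_def by simp
  then have "gform (gf f) P (vec_of_parts X (s *\<^sub>R X)) (vec_of_parts X (s *\<^sub>R X)) = \<epsilon>"
    by (simp add: gform_gf inner_commute[of "s *\<^sub>R X" X] power2_eq_square)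
  then show thesis using that parts_vec_of_parts(1) by blast
qed

lemma on_pair_gf_xpart_independent:
  assumes pair: "on_pair (gf f) P \<epsilon> e1 e2" and \<epsilon>: "\<epsilon> \<noteq> 0"
    and ab: "a *\<^sub>R xpart e1 + b *\<^sub>R xpart e2 = 0"
  shows "a = 0 \<and> b = 0"
proof -
  let ?v = "a *\<^sub>R e1 + b *\<^sub>R e2"
  have parts: "xpart ?v = a *\<^sub>R xpart e1 + b *\<^sub>R xpart e2" "ypart ?v = a *\<^sub>R ypart e1 + b *\<^sub>R ypart e2"
    by (simp_all add: xpart_def ypart_def vec_eq_iff)
  have "gform (gf f) P ?v ?v = a * a * gform (gf f) P e1 e1 + 2 * a * b * gform (gf f) P e1 e2
      + b * b * gform (gf f) P e2 e2"
    unfolding gform_gf parts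
    by (simp add: inner_add_left inner_add_right inner_commute[of "ypart e1" "xpart e2"]
        inner_commute[of "ypart e2" "xpart e1"] algebra_simps)
  moreover have "gform (gf f) P ?v ?v = 0" using ab parts(1) by (simp add: gform_gf)
  ultimately have "\<epsilon> * (a * a + b * b) = 0" using pair unfolding on_pair_def by (simp add: algebra_simps)
  then show ?thesis using \<epsilon> sum_squares_eq_zero_iff by auto
qed

section \<open>The Jacobi and plane operators of the Weyl tensor\<close>

lemma op_of_form_gf_upper_left_block:
  "op_of_form (gf f) P (upper_left_block N) = lower_left_block (transpose N)"
  unfolding op_of_form_def matrix_inv_gmat_gf
  by (simp add: vec_eq_iff all_sum_type matrix_matrix_mult_def lower_left_block_def upper_left_block_def
      gf_inv_def transpose_def sum_UNIV_sum_type if_distrib[of "\<lambda>x. x * _"] cong: if_cong)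

lemma hess_symmetric: "smooth_fun f \<Longrightarrow> hess f p $ j $ i = hess f p $ i $ j"
  by (simp add: hess_def pd_commute)

lemma inner_hess_axis:
  assumes "smooth_fun f"
  shows "u \<bullet> (hess f p *v axis j 1) = (hess f p *v u) $ j"
proof -
  have "u \<bullet> (hess f p *v axis j 1) = (\<Sum>i\<in>UNIV. u$i * hess f p $ i $ j)"
    by (simp add: inner_vec_def)
  also have "\<dots> = (hess f p *v u) $ j"
    by (simp add: matrix_vector_mult_def hess_symmetric[OF assms] mult.commute)
  finally show ?thesis .
qed

lemma jacobiW_gf:
  assumes f: "smooth_fun f"
  shows "jacobiW (gf f) P x = lower_left_block (curv_jacobi (hess f (xpart P)) (xpart x))"
proof -
  have "(\<chi> a b. weyl (gf f) P (axis a 1) x x (axis b 1))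
      = upper_left_block (transpose (curv_jacobi (hess f (xpart P)) (xpart x)))"
    by (simp add: vec_eq_iff all_sum_type upper_left_block_def transpose_def curv_jacobi_def
        weyl_gf[OF f] curv_gf[OF f] inner_axis' inner_hess_axis[OF f] hess_symmetric[OF f])
  then show ?thesis by (simp add: jacobiW_def op_of_form_gf_upper_left_block)
qed

lemma weylPi_gf:
  assumes f: "smooth_fun f"
  shows "weylPi (gf f) P e1 e2 = lower_left_block (curv_plane (hess f (xpart P)) (xpart e1) (xpart e2))"
proof -
  have "(\<chi> a b. weyl (gf f) P e1 e2 (axis a 1) (axis b 1))
      = upper_left_block (transpose (curv_plane (hess f (xpart P)) (xpart e1) (xpart e2)))"
    by (simp add: vec_eq_iff all_sum_type upper_left_block_def transpose_def curv_plane_def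
        weyl_gf[OF f] curv_gf[OF f] inner_axis' inner_hess_axis[OF f])
  then show ?thesis by (simp add: weylPi_def op_of_form_gf_upper_left_block)
qed

lemma rank_jacobiW_gf:
  "smooth_fun f \<Longrightarrow> rank (jacobiW (gf f) P x) = rank (curv_jacobi (hess f (xpart P)) (xpart x))"
  by (simp add: jacobiW_gf rank_lower_left_block)

lemma rank_weylPi_gf:
  "smooth_fun f \<Longrightarrow> rank (weylPi (gf f) P e1 e2) = rank (curv_plane (hess f (xpart P)) (xpart e1) (xpart e2))"
  by (simp add: weylPi_gf rank_lower_left_block)

lemma same_jnf_jacobiW_gf_iff:
  "smooth_fun f \<Longrightarrow> same_jnf (jacobiW (gf f) P x) (jacobiW (gf f) P y)
     \<longleftrightarrow> rank (jacobiW (gf f) P x) = rank (jacobiW (gf f) P y)"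
  by (simp add: jacobiW_gf same_jnf_lower_left_block_iff rank_lower_left_block)

lemma same_jnf_weylPi_gf_iff:
  "smooth_fun f \<Longrightarrow> same_jnf (weylPi (gf f) P e1 e2) (weylPi (gf f) P u1 u2)
     \<longleftrightarrow> rank (weylPi (gf f) P e1 e2) = rank (weylPi (gf f) P u1 u2)"
  by (simp add: weylPi_gf same_jnf_lower_left_block_iff rank_lower_left_block)

lemma jacobiW_gf_if_definite:
  fixes f :: "real^'n::finite \<Rightarrow> real"
  assumes f: "smooth_fun f" and H: "definite_mat (hess f (xpart P))" and x: "gform (gf f) P x x \<noteq> 0"
  shows "rank (jacobiW (gf f) P x) = CARD('n) - 1" "jacobiW (gf f) P x ** jacobiW (gf f) P x = 0"
proof -
  have "xpart x \<bullet> (hess f (xpart P) *v xpart x) \<noteq> 0"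
    using definite_mat_non_null[OF H xpart_neq_0_if_non_null[OF x]] .
  then show "rank (jacobiW (gf f) P x) = CARD('n) - 1"
    by (simp add: rank_jacobiW_gf[OF f] rank_curv_jacobi_non_null[OF definite_mat_inj[OF H]])
  show "jacobiW (gf f) P x ** jacobiW (gf f) P x = 0"
    by (simp add: jacobiW_gf[OF f] lower_left_block_mult_lower_left_block)
qed

lemma conf_JO_gf_if_definite:
  fixes f :: "real^'n::finite \<Rightarrow> real"
  assumes f: "smooth_fun f" and H: "\<And>P. definite_mat (hess f (xpart P))"
  shows "conf_spacelike_JO (gf f)" "conf_timelike_JO (gf f)"
proof -
  have "same_jnf (jacobiW (gf f) P x) (jacobiW (gf f) P y)"
    if "gform (gf f) P x x \<noteq> 0" "gform (gf f) P y y \<noteq> 0" for P x y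
    using jacobiW_gf_if_definite[OF f H] that by (simp add: same_jnf_jacobiW_gf_iff[OF f])
  then show "conf_spacelike_JO (gf f)" "conf_timelike_JO (gf f)"
    unfolding conf_spacelike_JO_def conf_timelike_JO_def by simp_all
qed

lemma not_conf_JO_gf_if_indefinite:
  fixes f :: "real^'n::finite \<Rightarrow> real"
  assumes f: "smooth_fun f" and card: "CARD('n) \<ge> 3" and H: "indefinite_mat (hess f (xpart P))"
  shows "\<not> conf_spacelike_JO (gf f)" "\<not> conf_timelike_JO (gf f)"
proof -
  obtain X1 X2 where X: "X1 \<noteq> 0" "X2 \<noteq> 0"
    "rank (curv_jacobi (hess f (xpart P)) X1) \<noteq> rank (curv_jacobi (hess f (xpart P)) X2)"
    using curv_jacobi_ranks_differ_if_indefinite[OF card H] by blast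
  have "\<exists>x y. gform (gf f) P x x = \<epsilon> \<and> gform (gf f) P y y = \<epsilon>
      \<and> \<not> same_jnf (jacobiW (gf f) P x) (jacobiW (gf f) P y)" for \<epsilon>
  proof -
    obtain x1 where "xpart x1 = X1" "gform (gf f) P x1 x1 = \<epsilon>"
      using exists_gf_vector_with_xpart[OF X(1)] .
    moreover obtain x2 where "xpart x2 = X2" "gform (gf f) P x2 x2 = \<epsilon>"
      using exists_gf_vector_with_xpart[OF X(2)] .
    ultimately show ?thesis
      using X(3) by (metis same_jnf_jacobiW_gf_iff[OF f] rank_jacobiW_gf[OF f])
  qed
  then show "\<not> conf_spacelike_JO (gf f)" "\<not> conf_timelike_JO (gf f)"
    unfolding conf_spacelike_JO_def conf_timelike_JO_def by blast+
qed

lemma weylPi_gf_if_nondegenerate: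
  assumes f: "smooth_fun f" and H: "nondegenerate_mat (hess f (xpart P))"
    and pair: "on_pair (gf f) P \<epsilon> e1 e2" and \<epsilon>: "\<epsilon> \<noteq> 0"
  shows "rank (weylPi (gf f) P e1 e2) = 2" "weylPi (gf f) P e1 e2 ** weylPi (gf f) P e1 e2 = 0"
proof -
  have "a = 0 \<and> b = 0"
    if "a *\<^sub>R (hess f (xpart P) *v xpart e1) + b *\<^sub>R (hess f (xpart P) *v xpart e2) = 0" for a b
  proof -
    have "hess f (xpart P) *v (a *\<^sub>R xpart e1 + b *\<^sub>R xpart e2) = 0"
      using that by (simp add: matrix_vector_right_distrib matrix_vector_mult_scaleR)
    then show ?thesis
      using on_pair_gf_xpart_independent[OF pair \<epsilon>] nondegenerate_mat_inj[OF H] by blast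
  qed
  then show "rank (weylPi (gf f) P e1 e2) = 2"
    by (simp add: rank_weylPi_gf[OF f] rank_curv_plane)
  show "weylPi (gf f) P e1 e2 ** weylPi (gf f) P e1 e2 = 0"
    by (simp add: weylPi_gf[OF f] lower_left_block_mult_lower_left_block)
qed

lemma conf_IP_gf_if_nondegenerate:
  assumes f: "smooth_fun f" and H: "\<And>P. nondegenerate_mat (hess f (xpart P))"
  shows "conf_spacelike_IP (gf f)" "conf_timelike_IP (gf f)"
proof -
  have same: "same_jnf (weylPi (gf f) P e1 e2) (weylPi (gf f) P u1 u2)"
    if "on_pair (gf f) P \<epsilon> e1 e2" "on_pair (gf f) P \<epsilon> u1 u2" "\<epsilon> \<noteq> 0" for P \<epsilon> e1 e2 u1 u2
    using weylPi_gf_if_nondegenerate[OF f H] that by (simp add: same_jnf_weylPi_gf_iff[OF f])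
  show "conf_spacelike_IP (gf f)" unfolding conf_spacelike_IP_def using same[where \<epsilon> = 1] by simp
  show "conf_timelike_IP (gf f)" unfolding conf_timelike_IP_def using same[where \<epsilon> = "-1"] by simp
qed

theorem theorem4p1:
  fixes f :: "real^'n::finite \<Rightarrow> real"
  assumes "CARD('n) \<ge> 3" and "smooth_fun f"
  shows
    "(\<forall>P::real^('n + 'n). definite_mat (hess f (xpart P)) \<longrightarrow>
        (\<forall>x. gform (gf f) P x x \<noteq> 0 \<longrightarrow>
             rank (jacobiW (gf f) P x) = CARD('n) - 1 \<and>
             jacobiW (gf f) P x ** jacobiW (gf f) P x = 0))
   \<and> ((\<forall>P::real^('n + 'n). definite_mat (hess f (xpart P))) \<longrightarrow>
        conf_spacelike_JO (gf f) \<and> conf_timelike_JO (gf f))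
   \<and> (\<forall>P::real^('n + 'n). indefinite_mat (hess f (xpart P)) \<longrightarrow>
        \<not> conf_spacelike_JO (gf f) \<and> \<not> conf_timelike_JO (gf f))
   \<and> (\<forall>P::real^('n + 'n). nondegenerate_mat (hess f (xpart P)) \<longrightarrow>
        (\<forall>e1 e2. on_pair (gf f) P 1 e1 e2 \<or> on_pair (gf f) P (-1) e1 e2 \<longrightarrow>
             rank (weylPi (gf f) P e1 e2) = 2 \<and>
             weylPi (gf f) P e1 e2 ** weylPi (gf f) P e1 e2 = 0))
   \<and> ((\<forall>P::real^('n + 'n). nondegenerate_mat (hess f (xpart P))) \<longrightarrow>
        conf_spacelike_IP (gf f) \<and> conf_timelike_IP (gf f))"
  using jacobiW_gf_if_definite[OF assms(2)] conf_JO_gf_if_definite[OF assms(2)]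
    not_conf_JO_gf_if_indefinite[OF assms(2,1)] weylPi_gf_if_nondegenerate[OF assms(2)]
    conf_IP_gf_if_nondegenerate[OF assms(2)]
  by auto

end
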